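(* For every prime $n>2$, $\Psi(n)\ge \left\lceil \frac{n-1}{4}\right\rceil$; that is, the graph of every permutation of $\mathbb{Z}_n$ contains at least $\lceil (n-1)/4\rceil$ collinear triples.
   Context: $\mathbb{Z}_n$ denotes the integers modulo $n$. A permutation of $\mathbb{Z}_n$ is a bijection $\sigma:\mathbb{Z}_n\to\mathbb{Z}_n$, and its graph is $\{(x,\sigma(x)) : x\in\mathbb{Z}_n\}\subset\mathbb{Z}_n\times\mathbb{Z}_n$. For $n$ prime, a set of points $X\subset\mathbb{Z}_n\times\mathbb{Z}_n$ is called collinear if there are $a,b,c\in\mathbb{Z}_n$ with $(a,b)\neq(0,0)$ such that every $(i,j)\in X$ lies on the line $\{(x,y)\in\mathbb{Z}_n\times\mathbb{Z}_n : ax+by=c\}$. A collinear triple is a collinear set of exactly three distinct points (triples are unordered). $\Psi(n)$ denotes the minimum, over all permutations $\sigma$ of $\mathbb{Z}_n$, of the number of collinear triples contained in the graph of $\sigma$. *)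

theory Defs
  imports Complex_Main "HOL-Number_Theory.Cong" "HOL-Computational_Algebra.Primes"
begin

(* The integers modulo n are represented by the residues 0, ..., n - 1; arithmetic modulo n
   is expressed by congruences. *)
definition residues_mod :: "nat \<Rightarrow> int set" where
  "residues_mod n = {0..<int n}"

definition permutation_mod :: "nat \<Rightarrow> (int \<Rightarrow> int) \<Rightarrow> bool" where
  "permutation_mod n \<sigma> \<longleftrightarrow> bij_betw \<sigma> (residues_mod n) (residues_mod n)"

definition graph_mod :: "nat \<Rightarrow> (int \<Rightarrow> int) \<Rightarrow> (int \<times> int) set" where
  "graph_mod n \<sigma> = (\<lambda>x. (x, \<sigma> x)) ` residues_mod n"

definition line_mod :: "nat \<Rightarrow> int \<Rightarrow> int \<Rightarrow> int \<Rightarrow> (int \<times> int) set" where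
  "line_mod n a b c =
     {(x, y). x \<in> residues_mod n \<and> y \<in> residues_mod n \<and> [a * x + b * y = c] (mod int n)}"

(* Only meant for prime n. *)
definition collinear_mod :: "nat \<Rightarrow> (int \<times> int) set \<Rightarrow> bool" where
  "collinear_mod n X \<longleftrightarrow>
     (\<exists>a\<in>residues_mod n. \<exists>b\<in>residues_mod n. \<exists>c\<in>residues_mod n.
        (a, b) \<noteq> (0, 0) \<and> X \<subseteq> line_mod n a b c)"

definition collinear_triples :: "nat \<Rightarrow> (int \<Rightarrow> int) \<Rightarrow> (int \<times> int) set set" where
  "collinear_triples n \<sigma> = {T. T \<subseteq> graph_mod n \<sigma> \<and> card T = 3 \<and> collinear_mod n T}"

(* The minimum is genuine: see finite_triple_counts and triple_counts_nonempty below. *)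
definition Psi :: "nat \<Rightarrow> nat" where
  "Psi n = Min {card (collinear_triples n \<sigma>) | \<sigma>. permutation_mod n \<sigma>}"

lemma finite_triple_counts:
  "finite {card (collinear_triples n \<sigma>) | \<sigma>. permutation_mod n \<sigma>}"
proof -
  let ?P = "Pow (residues_mod n \<times> residues_mod n)"
  have fin: "finite ?P" by (simp add: residues_mod_def)
  have "card (collinear_triples n \<sigma>) \<le> card ?P" if "permutation_mod n \<sigma>" for \<sigma>
  proof (rule card_mono[OF fin])
    have "graph_mod n \<sigma> \<subseteq> residues_mod n \<times> residues_mod n"
      using that bij_betwE unfolding permutation_mod_def graph_mod_def by fastforce
    then show "collinear_triples n \<sigma> \<subseteq> ?P"
      unfolding collinear_triples_def by blast
  qed
  then have "{card (collinear_triples n \<sigma>) | \<sigma>. permutation_mod n \<sigma>} \<subseteq> {..card ?P}"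
    by auto
  then show ?thesis by (rule finite_subset) simp
qed

lemma triple_counts_nonempty:
  "{card (collinear_triples n \<sigma>) | \<sigma>. permutation_mod n \<sigma>} \<noteq> {}"
proof -
  have "permutation_mod n id" by (simp add: permutation_mod_def)
  then show ?thesis by blast
qed

end

theory Submission
  imports Defs "HOL-Number_Theory.Residues"
begin

text \<open>
  Every point \<open>P\<close> of the graph lies in a collinear triple. Join \<open>P\<close> to the other
  \<open>n - 1\<close> points. Since \<open>\<sigma>\<close> is a permutation, neither coordinate difference
  vanishes, so each joining line has a slope among the \<open>n - 1\<close> nonzero residues. In each coordinate
  the differences run through all nonzero residues, so by Wilson's theorem both products of
  differences are \<open>-1\<close>, and the product of the slopes is \<open>(-1) / (-1) = 1\<close>. If the slopes
  were pairwise distinct, they too would be all the nonzero residues, with product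
  \<open>-1\<close>, which differs from \<open>1\<close> because \<open>n > 2\<close>. So two of the lines through \<open>P\<close>
  have equal slope and coincide, which yields a collinear triple through \<open>P\<close>.

  The collinear triples thus cover all \<open>n\<close> points of the graph, three at a time. Hence there are at
  least \<open>n / 3\<close> of them, which exceeds \<open>(n - 1) / 4\<close>.
\<close>

text \<open>
  A system of \<open>n - 1\<close> pairwise incongruent units is a permutation of \<open>1, ..., n - 1\<close> modulo \<open>n\<close>,
  so Wilson's theorem evaluates its product.
\<close>

lemma prod_reduced_residue_system:
  fixes f :: "'a \<Rightarrow> int"
  assumes "prime n" and card: "card A = n - 1"
    and inj: "inj_on (\<lambda>x. f x mod int n) A"
    and nz: "\<And>x. x \<in> A \<Longrightarrow> \<not> int n dvd f x"
  shows "[prod f A = -1] (mod int n)"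
proof -
  have n: "n \<ge> 2" using assms(1) prime_ge_2_nat by blast
  have sub: "(\<lambda>x. f x mod int n) ` A \<subseteq> {1..int (n - 1)}"
  proof
    fix y assume "y \<in> (\<lambda>x. f x mod int n) ` A"
    then obtain x where x: "x \<in> A" "y = f x mod int n" by blast
    have "y \<noteq> 0" using nz[OF x(1)] x(2) by (simp add: dvd_eq_mod_eq_0)
    moreover have "0 \<le> y" "y < int n" using x(2) n by simp_all
    ultimately show "y \<in> {1..int (n - 1)}" by auto
  qed
  have img: "(\<lambda>x. f x mod int n) ` A = {1..int (n - 1)}"
    by (rule card_subset_eq[OF _ sub]) (simp_all add: card_image[OF inj] card)
  have "[prod f A = (\<Prod>x\<in>A. f x mod int n)] (mod int n)"
    by (rule cong_prod) (simp add: cong_def)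
  also have "(\<Prod>x\<in>A. f x mod int n) = \<Prod>{1..int (n - 1)}"
    by (simp add: prod.reindex[OF inj, of "\<lambda>y. y", simplified comp_def, symmetric] img)
  also have "\<dots> = fact (n - 1)"
    using prod_int_eq[of 1 "n - 1"] by (simp add: fact_prod)
  also have "[fact (n - 1) = (-1 :: int)] (mod int n)"
    using wilson_theorem[OF assms(1)] .
  finally show ?thesis .
qed

lemma residues_mod_cong_iff:
  assumes "x \<in> residues_mod n" "y \<in> residues_mod n"
  shows "[x = y] (mod int n) \<longleftrightarrow> x = y"
  using assms by (simp add: residues_mod_def cong_def)

lemma card_residues_mod: "card (residues_mod n) = n"
  by (simp add: residues_mod_def)

text \<open>
  Applied with the identity for the horizontal differences from a point of the graph and with
  \<open>\<sigma>\<close> for the vertical ones.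
\<close>

lemma prod_differences:
  assumes "prime n" and g: "bij_betw g (residues_mod n) (residues_mod n)"
    and x0: "x0 \<in> residues_mod n"
  shows "[(\<Prod>x\<in>residues_mod n - {x0}. g x - g x0) = -1] (mod int n)"
proof (rule prod_reduced_residue_system[OF assms(1)])
  let ?R = "residues_mod n"
  have eq: "x = y" if "x \<in> ?R" "y \<in> ?R" "[g x = g y] (mod int n)" for x y
    using inj_onD[OF bij_betw_imp_inj_on[OF g] _ that(1,2)] that(3)
      residues_mod_cong_iff[OF bij_betw_apply[OF g that(1)] bij_betw_apply[OF g that(2)]]
    by simp
  show "card (?R - {x0}) = n - 1"
    using x0 by (simp add: card_residues_mod)
  show "inj_on (\<lambda>x. (g x - g x0) mod int n) (?R - {x0})"
  proof (rule inj_onI)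
    fix x y assume xy: "x \<in> ?R - {x0}" "y \<in> ?R - {x0}"
      and "(g x - g x0) mod int n = (g y - g x0) mod int n"
    then have "[g x = g y] (mod int n)"
      by (simp add: cong_iff_dvd_diff mod_eq_dvd_iff)
    with xy show "x = y" using eq by blast
  qed
  show "\<not> int n dvd g x - g x0" if "x \<in> ?R - {x0}" for x
    using that eq[of x x0] x0 by (auto simp: cong_iff_dvd_diff)
qed

text \<open>
  The line of slope \<open>m\<close> through a given point is \<open>m x + (n - 1) y = c\<close>: the coefficient
  \<open>n - 1\<close> is the residue representing \<open>-1\<close>.
\<close>

lemma collinear_mod_common_slope:
  assumes "n \<ge> 2" and X: "X \<subseteq> residues_mod n \<times> residues_mod n"
    and m: "m \<in> residues_mod n"
    and slope: "\<And>x y. (x, y) \<in> X \<Longrightarrow> [m * (x - x0) = y - y0] (mod int n)"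
  shows "collinear_mod n X"
proof -
  let ?c = "(m * x0 - y0) mod int n"
  have "X \<subseteq> line_mod n m (int n - 1) ?c"
  proof clarify
    fix x y assume xy: "(x, y) \<in> X"
    have "int n dvd m * (x - x0) - (y - y0)"
      using slope[OF xy] by (simp add: cong_iff_dvd_diff)
    then have "int n dvd m * (x - x0) - (y - y0) + int n * y" by simp
    also have "m * (x - x0) - (y - y0) + int n * y
        = m * x + (int n - 1) * y - (m * x0 - y0)"
      by (simp add: algebra_simps)
    finally have "[m * x + (int n - 1) * y = m * x0 - y0] (mod int n)"
      by (simp add: cong_iff_dvd_diff)
    then show "(x, y) \<in> line_mod n m (int n - 1) ?c"
      using X xy by (auto simp: line_mod_def cong_def)
  qed
  moreover have "int n - 1 \<in> residues_mod n" "?c \<in> residues_mod n"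
    using assms(1) by (auto simp: residues_mod_def)
  moreover have "(m, int n - 1) \<noteq> (0, 0)" using assms(1) by simp
  ultimately show ?thesis unfolding collinear_mod_def using m by blast
qed

text \<open>
  If the slopes \<open>m x\<close> of the lines to the other points were pairwise distinct, multiplying
  \<open>m x * (x - x0) = \<sigma> x - \<sigma> x0\<close> over all \<open>x\<close> would give \<open>(-1) * (-1) = -1\<close> modulo \<open>n\<close>, by
  Wilson's theorem for each of the three factors.
\<close>

lemma point_in_collinear_triple:
  assumes p: "prime n" "n > 2" and \<sigma>: "permutation_mod n \<sigma>"
    and x0: "x0 \<in> residues_mod n"
  shows "\<exists>T\<in>collinear_triples n \<sigma>. (x0, \<sigma> x0) \<in> T"
proof -
  let ?R = "residues_mod n" and ?A = "residues_mod n - {x0}"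
  have bij: "bij_betw \<sigma> ?R ?R" using \<sigma> by (simp add: permutation_mod_def)
  have dx: "\<not> int n dvd x - x0" if "x \<in> ?A" for x
    using that x0 residues_mod_cong_iff[of x n x0] by (auto simp: cong_iff_dvd_diff)
  have dy: "\<not> int n dvd \<sigma> x - \<sigma> x0" if "x \<in> ?A" for x
    using that x0 inj_onD[OF bij_betw_imp_inj_on[OF bij], of x x0]
      residues_mod_cong_iff[of "\<sigma> x" n "\<sigma> x0"] bij_betw_apply[OF bij]
    by (auto simp: cong_iff_dvd_diff)
  have "\<exists>m\<in>?R. [m * (x - x0) = \<sigma> x - \<sigma> x0] (mod int n)" if "x \<in> ?A" for x
  proof -
    have "coprime (x - x0) (int n)"
      using dx[OF that] p(1) by (metis coprime_commute prime_imp_coprime prime_nat_int_transfer)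
    then obtain u where u: "[(x - x0) * u = 1] (mod int n)"
      using cong_solve_coprime_int by blast
    let ?m = "(u * (\<sigma> x - \<sigma> x0)) mod int n"
    have "[?m * (x - x0) = u * (\<sigma> x - \<sigma> x0) * (x - x0)] (mod int n)"
      by (simp add: cong_def mod_mult_left_eq)
    also have "u * (\<sigma> x - \<sigma> x0) * (x - x0) = (x - x0) * u * (\<sigma> x - \<sigma> x0)"
      by (simp add: algebra_simps)
    also have "[\<dots> = 1 * (\<sigma> x - \<sigma> x0)] (mod int n)"
      by (rule cong_mult[OF u]) simp
    finally show ?thesis
      using p(2) by (intro bexI[of _ ?m]) (auto simp: residues_mod_def)
  qed
  then obtain m where m: "\<And>x. x \<in> ?A \<Longrightarrow> m x \<in> ?R"
    "\<And>x. x \<in> ?A \<Longrightarrow> [m x * (x - x0) = \<sigma> x - \<sigma> x0] (mod int n)" by metis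
  have m_nz: "\<not> int n dvd m x" if "x \<in> ?A" for x
    using m(2)[OF that] dy[OF that] by (metis cong_dvd_iff dvd_mult2)
  have "\<not> inj_on m ?A"
  proof
    assume inj: "inj_on m ?A"
    have "inj_on (\<lambda>x. m x mod int n) ?A"
    proof (rule inj_onI)
      fix x y assume "x \<in> ?A" "y \<in> ?A" "m x mod int n = m y mod int n"
      then show "x = y"
        using inj m(1) residues_mod_cong_iff by (metis cong_def inj_onD)
    qed
    then have prod_m: "[prod m ?A = -1] (mod int n)"
      using x0 m_nz
      by (intro prod_reduced_residue_system[OF p(1)]) (simp_all add: card_residues_mod)
    have prod_dx: "[(\<Prod>x\<in>?A. x - x0) = -1] (mod int n)"
      using prod_differences[OF p(1) _ x0, of "\<lambda>x. x"] by (simp add: bij_betw_def)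
    have "[prod m ?A * (\<Prod>x\<in>?A. x - x0) = (\<Prod>x\<in>?A. \<sigma> x - \<sigma> x0)] (mod int n)"
      unfolding prod.distrib[symmetric] by (rule cong_prod) (use m(2) in blast)
    with prod_differences[OF p(1) bij x0]
    have "[prod m ?A * (\<Prod>x\<in>?A. x - x0) = -1] (mod int n)" by (rule cong_trans[rotated])
    with cong_mult[OF prod_m prod_dx] have "[1 = (-1 :: int)] (mod int n)"
      by (metis cong_sym cong_trans mult_minus1 minus_minus)
    then have "int n dvd 2" by (simp add: cong_iff_dvd_diff)
    with p(2) show False using zdvd_imp_le by fastforce
  qed
  then obtain x y where xy: "x \<in> ?A" "y \<in> ?A" "x \<noteq> y" "m x = m y"
    by (auto simp: inj_on_def)
  let ?T = "{(x0, \<sigma> x0), (x, \<sigma> x), (y, \<sigma> y)}"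
  have "?T \<subseteq> graph_mod n \<sigma>" using xy x0 by (auto simp: graph_mod_def)
  moreover have "card ?T = 3" using xy by auto
  moreover have "collinear_mod n ?T"
  proof (rule collinear_mod_common_slope)
    show "n \<ge> 2" using p(2) by simp
    show "?T \<subseteq> ?R \<times> ?R" using xy x0 bij_betw_apply[OF bij] by auto
    show "m x \<in> ?R" using m(1) xy(1) by blast
    show "[m x * (u - x0) = v - \<sigma> x0] (mod int n)" if "(u, v) \<in> ?T" for u v
      using that m(2)[OF xy(1)] m(2)[OF xy(2)] xy(4) by auto
  qed
  ultimately have "?T \<in> collinear_triples n \<sigma>" by (simp add: collinear_triples_def)
  then show ?thesis by blast
qed

lemma card_collinear_triples_ge:
  assumes "prime n" "n > 2" and \<sigma>: "permutation_mod n \<sigma>"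
  shows "n \<le> 3 * card (collinear_triples n \<sigma>)"
proof -
  let ?C = "collinear_triples n \<sigma>"
  have card: "card (graph_mod n \<sigma>) = n"
    unfolding graph_mod_def by (subst card_image) (auto simp: inj_on_def card_residues_mod)
  have fin: "finite (graph_mod n \<sigma>)" by (simp add: graph_mod_def residues_mod_def)
  have C: "?C \<subseteq> Pow (graph_mod n \<sigma>)" by (auto simp: collinear_triples_def)
  have finC: "finite ?C" using finite_subset[OF C] fin by simp
  have "graph_mod n \<sigma> \<subseteq> \<Union>?C"
    using point_in_collinear_triple[OF assms] by (fastforce simp: graph_mod_def)
  then have "n \<le> card (\<Union>?C)"
    using card_mono[of "\<Union>?C" "graph_mod n \<sigma>"] C fin card
    by (metis Sup_le_iff PowD finite_subset subsetD)
  also have "\<dots> \<le> (\<Sum>T\<in>?C. card T)"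
    by (rule card_Union_le_sum_card)
  also have "\<dots> = 3 * card ?C" by (simp add: collinear_triples_def)
  finally show ?thesis .
qed

theorem corollary3:
  fixes n :: nat
  assumes "prime n" and "n > 2"
  shows "int (Psi n) \<ge> \<lceil>(real n - 1) / 4\<rceil> \<and>
    (\<forall>\<sigma>. permutation_mod n \<sigma> \<longrightarrow> int (card (collinear_triples n \<sigma>)) \<ge> \<lceil>(real n - 1) / 4\<rceil>)"
proof -
  have bound: "int (card (collinear_triples n \<sigma>)) \<ge> \<lceil>(real n - 1) / 4\<rceil>"
    if "permutation_mod n \<sigma>" for \<sigma>
    using card_collinear_triples_ge[OF assms that] by (simp add: ceiling_le_iff)
  have "Psi n \<in> {card (collinear_triples n \<sigma>) | \<sigma>. permutation_mod n \<sigma>}"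
    unfolding Psi_def by (rule Min_in[OF finite_triple_counts triple_counts_nonempty])
  then obtain \<sigma> where "permutation_mod n \<sigma>" "Psi n = card (collinear_triples n \<sigma>)"
    by auto
  then have "int (Psi n) \<ge> \<lceil>(real n - 1) / 4\<rceil>" using bound by metis
  with bound show ?thesis by blast
qed

end
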